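(* For every finite field $\mathbb{F}$ and every integer $d\geq 2$ there is a constant $c\in(0,1]$ such that the following holds. Let $n\geq t\geq r\geq 1$ be integers and let $V\subseteq \mathbb{F}^{n\times\cdots\times n}$ be a subspace of $d$-tensors. If $\dim(V)\geq t n^{d-1}$, then there is a subspace $W\subseteq V$ of dimension at least $\frac{t}{dr}-1$ such that every nonzero element of $W$ has analytic rank at least $cr$.
   Context: A $d$-tensor $T\in\mathbb{F}^{n\times\cdots\times n}$ ($d$ factors) is identified with the $d$-linear form $T:\mathbb{F}^n\times\cdots\times\mathbb{F}^n\to\mathbb{F}$ whose value on standard basis vectors $(e_{i_1},\dots,e_{i_d})$ is the $(i_1,\dots,i_d)$ entry. For a nontrivial additive character $\chi:\mathbb{F}\to\mathbb{C}$, the bias of $T$ is $\mathrm{bias}(T)=|\mathbb{F}|^{-nd}\sum_{x_1,\dots,x_d\in\mathbb{F}^n}\chi(T(x_1,\dots,x_d))$ (this is a positive real number independent of the choice of $\chi$), and the analytic rank is $\mathrm{arank}(T)=-\log_{|\mathbb{F}|}\mathrm{bias}(T)$. *)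

theory Defs
  imports Complex_Main "HOL-Library.FuncSet" "HOL-Library.Function_Algebras"
    "HOL-Library.Cardinality"
begin

text \<open>Since \<open>d\<close> and \<open>n\<close> vary inside the statement, a tensor is a function on all of
  \<open>nat \<Rightarrow> nat\<close> that vanishes off the index tuples \<open>{..<d} \<rightarrow>\<^sub>E {..<n}\<close>; addition and zero are
  the pointwise ones.\<close>

type_synonym 'f tensor = "(nat \<Rightarrow> nat) \<Rightarrow> 'f"

definition tensor_space :: "nat \<Rightarrow> nat \<Rightarrow> 'f::field tensor set" where
  "tensor_space d n = {T. \<forall>i. i \<notin> ({..<d} \<rightarrow>\<^sub>E {..<n}) \<longrightarrow> T i = 0}"

definition tensor_scale :: "'f::field \<Rightarrow> 'f tensor \<Rightarrow> 'f tensor" where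
  "tensor_scale a T = (\<lambda>i. a * T i)"

global_interpretation tensor: vector_space "tensor_scale :: 'f::field \<Rightarrow> 'f tensor \<Rightarrow> 'f tensor"
  by unfold_locales (simp_all add: tensor_scale_def fun_eq_iff algebra_simps)

definition vecs :: "nat \<Rightarrow> (nat \<Rightarrow> 'f) set" where
  "vecs n = {..<n} \<rightarrow>\<^sub>E UNIV"

definition tensor_form :: "nat \<Rightarrow> nat \<Rightarrow> 'f::field tensor \<Rightarrow> (nat \<Rightarrow> nat \<Rightarrow> 'f) \<Rightarrow> 'f" where
  "tensor_form d n T x = (\<Sum>i\<in>{..<d} \<rightarrow>\<^sub>E {..<n}. T i * (\<Prod>k<d. x k (i k)))"

lemma tensor_form_basis:
  assumes "i \<in> {..<d} \<rightarrow>\<^sub>E {..<n}"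
  shows "tensor_form d n T (\<lambda>k\<in>{..<d}. \<lambda>j\<in>{..<n}. if j = i k then 1 else 0) = T i"
proof -
  let ?e = "\<lambda>k\<in>{..<d}. \<lambda>j\<in>{..<n}. if j = i k then 1 else (0::'a)"
  have e: "?e k (i' k) = (if i' k = i k then 1 else 0)"
    if "i' \<in> {..<d} \<rightarrow>\<^sub>E {..<n}" "k < d" for i' k
    using PiE_mem[OF that(1), of k] that(2) by simp
  have "T i' * (\<Prod>k<d. ?e k (i' k)) = (if i' = i then T i' else 0)"
    if i': "i' \<in> {..<d} \<rightarrow>\<^sub>E {..<n}" for i'
  proof -
    have "(\<Prod>k<d. ?e k (i' k)) = (\<Prod>k<d. if i' k = i k then 1 else 0)"
      by (rule prod.cong[OF refl], rule e[OF i']) simp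
    moreover have "\<exists>k<d. i' k \<noteq> i k" if "i' \<noteq> i"
      using PiE_ext[OF i' assms] that by blast
    ultimately show ?thesis
      by (cases "i' = i") (auto simp: prod_zero_iff)
  qed
  then have "tensor_form d n T ?e = (\<Sum>i'\<in>{..<d} \<rightarrow>\<^sub>E {..<n}. if i' = i then T i' else 0)"
    unfolding tensor_form_def by (rule sum.cong[OF refl])
  also have "\<dots> = T i"
    using assms by (subst sum.delta) (simp_all add: finite_PiE)
  finally show ?thesis .
qed

definition nontrivial_additive_character :: "('f::field \<Rightarrow> complex) \<Rightarrow> bool" where
  "nontrivial_additive_character \<chi> \<longleftrightarrow>
     \<chi> 0 = 1 \<and> (\<forall>a b. \<chi> (a + b) = \<chi> a * \<chi> b) \<and> (\<exists>a. \<chi> a \<noteq> 1)"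

definition bias ::
    "('f::{field,finite} \<Rightarrow> complex) \<Rightarrow> nat \<Rightarrow> nat \<Rightarrow> 'f tensor \<Rightarrow> complex" where
  "bias \<chi> d n T =
     (\<Sum>x\<in>{..<d} \<rightarrow>\<^sub>E vecs n. \<chi> (tensor_form d n T x)) / of_nat (CARD('f) ^ (n * d))"

text \<open>The bias is a positive real number, so taking the real part loses nothing.\<close>

definition analytic_rank ::
    "('f::{field,finite} \<Rightarrow> complex) \<Rightarrow> nat \<Rightarrow> nat \<Rightarrow> 'f tensor \<Rightarrow> real" where
  "analytic_rank \<chi> d n T = - log (real CARD('f)) (Re (bias \<chi> d n T))"

end

theory Submission
  imports Defs "HOL-Library.Infinite_Set"
begin

text \<open>
  Call \<open>p\<close> a leading position of \<open>V\<close> if it is the colexicographically first index of the support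
  of some tensor in \<open>V\<close>. There are at least \<open>dim V \<ge> t n\<^sup>d\<^sup>-\<^sup>1\<close> leading positions, and the box
  \<open>[n]\<^sup>d\<close> is covered by \<open>d n\<^sup>d\<^sup>-\<^sup>1\<close> diagonals, so some diagonal carries \<open>m \<ge> t / d\<close> leading positions
  \<open>p\<^sub>0 < \<dots> < p\<^sub>m\<^sub>-\<^sub>1\<close>, attained by tensors \<open>T\<^sub>k\<close>. These are cut into blocks of \<open>r\<close> consecutive ones.

  In a block, the system \<open>T\<^sub>k(y) = 0\<close> is triangular. Revealing the coordinates of \<open>y\<close> one at a time,
  the nonzero values are at least as frequent as the successes of independent trials of success
  probability \<open>(1 - 1/q)\<^sup>d\<close>, so all \<open>T\<^sub>k(y)\<close> vanish with probability at most
  \<open>\<mu>\<^sup>r\<close>, where \<open>\<mu> = 1 - (1 - 1/q)\<^sup>d\<close>. This probability is the average bias of the linear combinations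
  of the \<open>T\<^sub>k\<close>, so some combination \<open>A\<close> has bias at most \<open>\<mu>\<^sup>r\<close>. This remains true after restricting
  the last mode to the indices up to those of the block; the restriction kills all later blocks
  and can only increase the bias. Hence in the span of the chosen combinations, one per block, the
  first block that occurs in a tensor already bounds its bias.
\<close>

section \<open>Weighted counts of solutions of triangular systems\<close>

lemma sum_PiE_insert:
  assumes "x \<notin> S"
  shows "(\<Sum>f\<in>Pi\<^sub>E (insert x S) A. h f) = (\<Sum>y\<in>A x. \<Sum>g\<in>Pi\<^sub>E S A. h (g(x := y)))"
proof -
  have "(\<Sum>f\<in>Pi\<^sub>E (insert x S) A. h f) = (\<Sum>(y, g)\<in>A x \<times> Pi\<^sub>E S A. h (g(x := y)))"
    unfolding PiE_insert_eq
    by (subst sum.reindex[OF inj_combinator[OF assms]]) (simp add: case_prod_unfold)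
  then show ?thesis
    by (simp add: sum.cartesian_product)
qed

lemma sum_PiE_lessThan_Suc:
  "(\<Sum>f\<in>{..<Suc d} \<rightarrow>\<^sub>E A. h f) = (\<Sum>g\<in>{..<d} \<rightarrow>\<^sub>E A. \<Sum>y\<in>A. h (g(d := y)))"
  unfolding lessThan_Suc by (subst sum_PiE_insert) (simp, rule sum.swap)

text \<open>For \<open>a \<noteq> 0\<close> there is exactly one root, so the sum is
  \<open>1 + (q - 1) * l\<close> with \<open>q = CARD('f)\<close>. For \<open>a = 0\<close> every
  weight is bounded by 1, whether or not \<open>b\<close> vanishes.\<close>

lemma sum_affine_weight_le:
  fixes a b :: "'f::{field,finite}" and l :: real
  assumes "l \<le> 1"
  shows "(\<Sum>w\<in>UNIV. if a * w + b = 0 then 1 else l)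
    \<le> real CARD('f) * (if a = 0 then 1 else 1 - (1 - 1 / real CARD('f)) * (1 - l))"
proof (cases "a = 0")
  case True
  have "(\<Sum>w\<in>(UNIV :: 'f set). if a * w + b = 0 then 1 else l) \<le> (\<Sum>w\<in>(UNIV :: 'f set). 1)"
    by (rule sum_mono) (use assms in auto)
  with True show ?thesis by simp
next
  case False
  have "a * w + b = 0 \<longleftrightarrow> w = - b / a" for w
    using False by (auto simp: field_simps eq_neg_iff_add_eq_0 add.commute)
  then have "(\<Sum>w\<in>(UNIV :: 'f set). if a * w + b = 0 then 1 else l)
      = (\<Sum>w\<in>(UNIV :: 'f set). l + (if w = - b / a then 1 - l else 0))"
    by (intro sum.cong) auto
  also have "\<dots> = real CARD('f) * l + (1 - l)"
    by (subst sum.distrib) simp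
  also have "\<dots> = real CARD('f) * (1 - (1 - 1 / real CARD('f)) * (1 - l))"
    by (simp add: field_simps)
  finally show ?thesis
    using False by simp
qed

text \<open>Each equation \<open>k\<close> has its own pivot variable \<open>v k\<close>, and
  \<open>g k\<close> depends only on variables ranked strictly below it. Summing out the variable of
  highest rank first therefore touches at most one factor of the product. With \<open>l = 0\<close>
  the left side counts solutions; a general \<open>l\<close> is needed so that the bound can be
  iterated over the modes of a tensor.\<close>

lemma triangular_system_sum_le:
  fixes a :: "'k \<Rightarrow> 'f::{field,finite}" and g :: "'k \<Rightarrow> ('i \<Rightarrow> 'f) \<Rightarrow> 'f"
    and rk :: "'i \<Rightarrow> 'o::linorder" and l :: real
  assumes "finite J" "finite K" "v ` K \<subseteq> J" "inj_on v K" "0 \<le> l" "l \<le> 1"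
    and "\<And>k i z w. k \<in> K \<Longrightarrow> i \<in> J \<Longrightarrow> rk (v k) \<le> rk i \<Longrightarrow> g k (z(i := w)) = g k z"
  shows "(\<Sum>z\<in>J \<rightarrow>\<^sub>E UNIV. \<Prod>k\<in>K. if a k * z (v k) + g k z = 0 then 1 else l)
    \<le> real CARD('f) ^ card J *
        (\<Prod>k\<in>K. if a k = 0 then 1 else 1 - (1 - 1 / real CARD('f)) * (1 - l))"
  using assms(1,2,3,4,7)
proof (induction J arbitrary: K rule: finite_ranking_induct[where f = rk])
  case empty
  then show ?case by simp
next
  case (insert x S)
  show ?case
  proof (cases "x \<in> S")
    case True
    then show ?thesis using insert by (simp add: insert_absorb)
  next
    case xS: False
    define \<phi> where "\<phi> k z = (if a k * z (v k) + g k z = 0 then 1 else l)" for k z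
    define \<psi> where "\<psi> k = (if a k = 0 then 1 else 1 - (1 - 1 / real CARD('f)) * (1 - l))" for k
    define K0 where "K0 = {k\<in>K. v k = x}"
    define K1 where "K1 = {k\<in>K. v k \<noteq> x}"
    have K: "K = K0 \<union> K1" "K0 \<inter> K1 = {}" "finite K0" "finite K1"
      using insert by (auto simp: K0_def K1_def)
    have q: "1 / real CARD('f) \<le> 1" "1 / real CARD('f) \<ge> 0"
      by (simp_all add: Suc_leI)
    have nonneg: "\<psi> k \<ge> 0" for k
    proof -
      have "(1 - 1 / real CARD('f)) * (1 - l) \<le> 1 * 1"
        using q assms(5,6) by (intro mult_mono) auto
      then show ?thesis by (simp add: \<psi>_def)
    qed
    have \<phi>_nonneg: "\<phi> k z \<ge> 0" for k z
      using assms(5) by (simp add: \<phi>_def)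
    \<comment> \<open>The new variable \<open>x\<close> has the highest rank, so equations with
      another pivot do not see it.\<close>
    have stable: "\<phi> k (z(x := w)) = \<phi> k z" if "k \<in> K1" for k z w
    proof -
      have "v k \<in> S" "v k \<noteq> x" "k \<in> K" using that insert(5) by (auto simp: K1_def)
      then have "g k (z(x := w)) = g k z"
        using insert(7)[of k x] insert(2) by blast
      then show ?thesis using \<open>v k \<noteq> x\<close> by (simp add: \<phi>_def)
    qed
    \<comment> \<open>Pivots are distinct, so \<open>K0\<close> has at most one element.\<close>
    have pivot: "(\<Sum>w\<in>UNIV. \<Prod>k\<in>K0. \<phi> k (z(x := w))) \<le> real CARD('f) * (\<Prod>k\<in>K0. \<psi> k)" for z
    proof (cases "K0 = {}")
      case False
      then obtain k where k: "k \<in> K0" by blast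
      then have K0: "K0 = {k}"
        using insert(6) by (auto simp: K0_def inj_on_def)
      have "g k (z(x := w)) = g k z" for w
        by (rule insert(7)) (use k in \<open>auto simp: K0_def\<close>)
      then have "(\<Sum>w\<in>UNIV. \<phi> k (z(x := w)))
          = (\<Sum>w\<in>UNIV. if a k * w + g k z = 0 then 1 else l)"
        using k by (intro sum.cong) (auto simp: \<phi>_def K0_def)
      also have "\<dots> \<le> real CARD('f) * \<psi> k"
        unfolding \<psi>_def by (rule sum_affine_weight_le[OF assms(6)])
      finally show ?thesis by (simp add: K0)
    qed simp
    have "(\<Sum>z\<in>insert x S \<rightarrow>\<^sub>E UNIV. \<Prod>k\<in>K. \<phi> k z)
        = (\<Sum>w\<in>UNIV. \<Sum>z\<in>S \<rightarrow>\<^sub>E UNIV. (\<Prod>k\<in>K0. \<phi> k (z(x := w))) * (\<Prod>k\<in>K1. \<phi> k z))"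
      by (subst sum_PiE_insert[OF xS]) (simp add: K(1) prod.union_disjoint[OF K(3,4,2)] stable)
    also have "\<dots> = (\<Sum>z\<in>S \<rightarrow>\<^sub>E UNIV. (\<Sum>w\<in>UNIV. \<Prod>k\<in>K0. \<phi> k (z(x := w))) * (\<Prod>k\<in>K1. \<phi> k z))"
      by (subst sum.swap) (simp add: sum_distrib_right)
    also have "\<dots> \<le> (\<Sum>z\<in>S \<rightarrow>\<^sub>E UNIV. (real CARD('f) * (\<Prod>k\<in>K0. \<psi> k)) * (\<Prod>k\<in>K1. \<phi> k z))"
      by (intro sum_mono mult_right_mono pivot prod_nonneg) (simp add: \<phi>_nonneg)
    also have "\<dots> = (real CARD('f) * (\<Prod>k\<in>K0. \<psi> k)) * (\<Sum>z\<in>S \<rightarrow>\<^sub>E UNIV. \<Prod>k\<in>K1. \<phi> k z)"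
      by (simp add: sum_distrib_left)
    also have "\<dots> \<le> (real CARD('f) * (\<Prod>k\<in>K0. \<psi> k)) * (real CARD('f) ^ card S * (\<Prod>k\<in>K1. \<psi> k))"
    proof (intro mult_left_mono)
      have "v ` K1 \<subseteq> S" "inj_on v K1"
        using insert(5,6) by (auto simp: K1_def inj_on_def)
      then show "(\<Sum>z\<in>S \<rightarrow>\<^sub>E UNIV. \<Prod>k\<in>K1. \<phi> k z) \<le> real CARD('f) ^ card S * (\<Prod>k\<in>K1. \<psi> k)"
        unfolding \<phi>_def \<psi>_def using insert(7) K(4)
        by (intro insert(3)) (auto simp: K1_def)
      show "0 \<le> real CARD('f) * (\<Prod>k\<in>K0. \<psi> k)"
        by (simp add: prod_nonneg nonneg)
    qed
    also have "\<dots> = real CARD('f) ^ card (insert x S) * (\<Prod>k\<in>K. \<psi> k)"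
      using xS insert(1) by (simp add: K(1) prod.union_disjoint[OF K(3,4,2)])
    finally show ?thesis unfolding \<phi>_def \<psi>_def .
  qed
qed

section \<open>Slices along the last mode and colexicographic leading positions\<close>

text \<open>The entry of \<open>i\<close> at \<open>d\<close> is overwritten, so a slice need not
  vanish off the box of the first \<open>d\<close> modes. This is harmless because
  \<open>tensor_form\<close> and \<open>leading\<close> read a slice on that box only.\<close>

definition slice :: "nat \<Rightarrow> nat \<Rightarrow> 'f::field tensor \<Rightarrow> 'f tensor" where
  "slice d j T = (\<lambda>i. T (i(d := j)))"

lemma tensor_form_fun_upd [simp]: "tensor_form d n T (y(d := z)) = tensor_form d n T y"
  unfolding tensor_form_def by (intro sum.cong arg_cong2[where f = "(*)"] prod.cong) auto

lemma tensor_form_Suc: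
  "tensor_form (Suc d) n T y = (\<Sum>j<n. y d j * tensor_form d n (slice d j T) y)"
proof -
  have "(\<Prod>k<Suc d. y k ((i(d := j)) k)) = y d j * (\<Prod>k<d. y k (i k))" for i j
    by (simp add: mult.commute)
  then show ?thesis
    unfolding tensor_form_def sum_PiE_lessThan_Suc slice_def
    by (subst sum.swap) (simp add: sum_distrib_left mult.left_commute del: prod.lessThan_Suc)
qed

lemma tensor_form_eq_0:
  "(\<And>i. i \<in> {..<d} \<rightarrow>\<^sub>E {..<n} \<Longrightarrow> T i = 0) \<Longrightarrow> tensor_form d n T y = 0"
  by (simp add: tensor_form_def)

lemma card_vecs: "card (vecs n :: (nat \<Rightarrow> 'f::finite) set) = CARD('f) ^ n"
  by (simp add: vecs_def card_funcsetE)

lemma finite_vecs [simp]: "finite (vecs n :: (nat \<Rightarrow> 'f::finite) set)"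
  by (simp add: vecs_def finite_PiE)

text \<open>Comparing codes is the colexicographic order: the last coordinate is the most
  significant one, matching the recursion on \<open>d\<close> that splits off the last mode.\<close>

definition index_code :: "nat \<Rightarrow> nat \<Rightarrow> (nat \<Rightarrow> nat) \<Rightarrow> nat" where
  "index_code d n i = (\<Sum>s<d. i s * n ^ s)"

lemma index_code_Suc: "index_code (Suc d) n i = index_code d n i + i d * n ^ d"
  by (simp add: index_code_def)

lemma index_code_cong: "(\<And>s. s < d \<Longrightarrow> i s = i' s) \<Longrightarrow> index_code d n i = index_code d n i'"
  by (simp add: index_code_def)

lemma index_code_less:
  "(\<And>s. s < d \<Longrightarrow> i s < n) \<Longrightarrow> index_code d n i < n ^ d"
proof (induction d)
  case 0
  then show ?case by (simp add: index_code_def)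
next
  case (Suc d)
  have "index_code (Suc d) n i < n ^ d + i d * n ^ d"
    using Suc by (simp add: index_code_Suc)
  also have "\<dots> = Suc (i d) * n ^ d" by simp
  also have "\<dots> \<le> n * n ^ d" using Suc.prems[of d] by (intro mult_right_mono) auto
  finally show ?case by simp
qed

text \<open>This is uniqueness of base \<open>n\<close> digits: reducing modulo \<open>n ^ d\<close>
  strips the top digit.\<close>

lemma index_code_eqD:
  assumes "\<And>s. s < d \<Longrightarrow> i s < n" "\<And>s. s < d \<Longrightarrow> i' s < n"
    and "index_code d n i = index_code d n i'" "s < d"
  shows "i s = i' s"
  using assms
proof (induction d)
  case (Suc d)
  have lt: "index_code d n i < n ^ d" "index_code d n i' < n ^ d"
    using Suc.prems by (auto intro: index_code_less)
  have "index_code (Suc d) n i mod n ^ d = index_code (Suc d) n i' mod n ^ d"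
    using Suc.prems(3) by simp
  with lt have "index_code d n i = index_code d n i'"
    by (simp add: index_code_Suc)
  moreover from this have "i d = i' d"
    using Suc.prems(3) lt by (metis index_code_Suc add_left_cancel mult_cancel2 not_less0)
  ultimately show ?case using Suc by (cases "s = d") auto
qed simp

text \<open>The analogue of the pivot column of a row in echelon form.\<close>

definition leading :: "nat \<Rightarrow> nat \<Rightarrow> 'f::field tensor \<Rightarrow> (nat \<Rightarrow> nat) \<Rightarrow> bool" where
  "leading d n T p \<longleftrightarrow> p \<in> {..<d} \<rightarrow>\<^sub>E {..<n} \<and> T p \<noteq> 0 \<and>
     (\<forall>i\<in>{..<d} \<rightarrow>\<^sub>E {..<n}. index_code d n i < index_code d n p \<longrightarrow> T i = 0)"

lemma fun_upd_in_PiE_Suc: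
  "i \<in> {..<d} \<rightarrow>\<^sub>E A \<Longrightarrow> j \<in> A \<Longrightarrow> i(d := j) \<in> {..<Suc d} \<rightarrow>\<^sub>E A"
  by (auto simp: PiE_iff extensional_def less_Suc_eq)

text \<open>Among tuples with the same last coordinate, comparing codes means comparing the first
  \<open>d\<close> coordinates.\<close>

lemma leading_slice:
  assumes "leading (Suc d) n T p"
  shows "leading d n (slice d (p d) T) (restrict p {..<d})"
proof -
  have p: "p \<in> {..<Suc d} \<rightarrow>\<^sub>E {..<n}" using assms by (simp add: leading_def)
  have "(restrict p {..<d})(d := p d) = p"
    using p by (auto simp: fun_eq_iff PiE_iff extensional_def restrict_def)
  moreover have "T (i(d := p d)) = 0"
    if "i \<in> {..<d} \<rightarrow>\<^sub>E {..<n}" "index_code d n i < index_code d n p" for i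
  proof -
    have "i(d := p d) \<in> {..<Suc d} \<rightarrow>\<^sub>E {..<n}"
      using that p by (intro fun_upd_in_PiE_Suc) auto
    moreover have "index_code (Suc d) n (i(d := p d)) < index_code (Suc d) n p"
      using that index_code_cong[of d i "i(d := p d)"] by (simp add: index_code_Suc)
    ultimately show ?thesis using assms by (simp add: leading_def)
  qed
  moreover have "index_code d n (restrict p {..<d}) = index_code d n p"
    by (rule index_code_cong) simp
  ultimately show ?thesis
    using assms p by (auto simp: leading_def slice_def)
qed

text \<open>A smaller last coordinate makes the code smaller, whatever the other coordinates
  are.\<close>

lemma leading_slice_eq_0:
  assumes "leading (Suc d) n T p" "j < p d" "i \<in> {..<d} \<rightarrow>\<^sub>E {..<n}"
  shows "slice d j T i = 0"
proof -
  have p: "p \<in> {..<Suc d} \<rightarrow>\<^sub>E {..<n}" using assms by (simp add: leading_def)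
  then have "p d < n" by auto
  then have mem: "i(d := j) \<in> {..<Suc d} \<rightarrow>\<^sub>E {..<n}"
    using assms by (intro fun_upd_in_PiE_Suc) auto
  have "index_code d n (i(d := j)) < n ^ d"
    by (rule index_code_less) (use assms(3) in auto)
  then have "index_code (Suc d) n (i(d := j)) < Suc j * n ^ d"
    by (simp add: index_code_Suc)
  also have "\<dots> \<le> p d * n ^ d" using assms(2) by (intro mult_right_mono) auto
  also have "\<dots> \<le> index_code (Suc d) n p" by (simp add: index_code_Suc)
  finally show ?thesis using assms(1) mem by (simp add: leading_def slice_def)
qed

section \<open>Joint vanishing of tensors with distinct leading coordinates\<close>

text \<open>Induction on \<open>d\<close>, summing over the last vector first. For fixed other
  vectors, the equations in the last vector are triangular with pivots \<open>p k d\<close>, and the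
  pivot coefficients are forms of slices that have leading positions again. Each mode thus replaces
  \<open>T k\<close> by a slice and \<open>1 - l\<close> by \<open>(1 - 1 / q) * (1 - l)\<close>,
  where \<open>q = CARD('f)\<close>.\<close>

lemma sum_weight_leading_le:
  fixes T :: "'k \<Rightarrow> 'f::{field,finite} tensor" and l :: real
  assumes "finite K" "\<And>k. k \<in> K \<Longrightarrow> leading d n (T k) (p k)"
    and "\<And>s. s < d \<Longrightarrow> inj_on (\<lambda>k. p k s) K" "0 \<le> l" "l \<le> 1"
  shows "(\<Sum>y\<in>{..<d} \<rightarrow>\<^sub>E vecs n. \<Prod>k\<in>K. if tensor_form d n (T k) y = 0 then 1 else l)
    \<le> real CARD('f) ^ (n * d) * (1 - (1 - 1 / real CARD('f)) ^ d * (1 - l)) ^ card K"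
  using assms
proof (induction d arbitrary: T p l)
  case 0
  \<comment> \<open>With no modes the form is the nonzero entry at the only tuple, so every factor
    equals \<open>l\<close>.\<close>
  have "T k (\<lambda>_. undefined) \<noteq> 0" if "k \<in> K" for k
    using 0(2)[OF that] by (auto simp: leading_def)
  then show ?case by (simp add: tensor_form_def)
next
  case (Suc d)
  define q where "q = real CARD('f)"
  define l' where "l' = 1 - (1 - 1 / q) * (1 - l)"
  define c where "c k j y = tensor_form d n (slice d j (T k)) y" for k j y
  have q: "1 / q \<le> 1" "1 / q \<ge> 0" "q > 0"
    by (simp_all add: Suc_leI q_def)
  have l': "0 \<le> l'" "l' \<le> 1"
  proof -
    have "(1 - 1 / q) * (1 - l) \<le> 1 * 1"
      using q Suc.prems by (intro mult_mono) auto
    then show "0 \<le> l'" by (simp add: l'_def)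
    show "l' \<le> 1" using q Suc.prems by (simp add: l'_def)
  qed
  have pn: "p k d < n" if "k \<in> K" for k
    using Suc.prems(2)[OF that] by (auto simp: leading_def)
  have form: "tensor_form (Suc d) n (T k) (y(d := z))
      = c k (p k d) y * z (p k d) + (\<Sum>j\<in>{p k d<..<n}. z j * c k j y)" if "k \<in> K" for k y z
  proof -
    have "tensor_form (Suc d) n (T k) (y(d := z)) = (\<Sum>j<n. z j * c k j y)"
      by (simp add: tensor_form_Suc c_def)
    also have "\<dots> = (\<Sum>j\<in>{p k d..<n}. z j * c k j y)"
      using leading_slice_eq_0[OF Suc.prems(2)[OF that]]
      by (intro sum.mono_neutral_right) (auto simp: c_def tensor_form_eq_0)
    also have "{p k d..<n} = insert (p k d) {p k d<..<n}"
      using pn[OF that] by auto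
    also have "(\<Sum>j\<in>insert (p k d) {p k d<..<n}. z j * c k j y)
        = c k (p k d) y * z (p k d) + (\<Sum>j\<in>{p k d<..<n}. z j * c k j y)"
      by (simp add: mult.commute)
    finally show ?thesis .
  qed
  have inner: "(\<Sum>z\<in>vecs n. \<Prod>k\<in>K. if tensor_form (Suc d) n (T k) (y(d := z)) = 0 then 1 else l)
      \<le> q ^ n * (\<Prod>k\<in>K. if c k (p k d) y = 0 then 1 else l')" for y
  proof -
    have "(\<Sum>z\<in>{..<n} \<rightarrow>\<^sub>E UNIV. \<Prod>k\<in>K.
        if c k (p k d) y * z (p k d) + (\<Sum>j\<in>{p k d<..<n}. z j * c k j y) = 0 then 1 else l)
      \<le> real CARD('f) ^ card {..<n} *
        (\<Prod>k\<in>K. if c k (p k d) y = 0 then 1 else 1 - (1 - 1 / real CARD('f)) * (1 - l))"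
      \<comment> \<open>The pivot is the smallest index that occurs in its equation, whereas the
        system lemma wants it ranked highest; the sign reverses the order.\<close>
      by (rule triangular_system_sum_le[where rk = "\<lambda>j. - int j"])
        (use Suc.prems pn in \<open>auto intro!: sum.cong\<close>)
    then show ?thesis
      unfolding vecs_def l'_def q_def by (simp add: form)
  qed
  have "(\<Sum>y\<in>{..<Suc d} \<rightarrow>\<^sub>E vecs n. \<Prod>k\<in>K. if tensor_form (Suc d) n (T k) y = 0 then 1 else l)
      \<le> (\<Sum>y\<in>{..<d} \<rightarrow>\<^sub>E vecs n. q ^ n * (\<Prod>k\<in>K. if c k (p k d) y = 0 then 1 else l'))"
    unfolding sum_PiE_lessThan_Suc by (intro sum_mono inner)
  also have "\<dots> = q ^ n * (\<Sum>y\<in>{..<d} \<rightarrow>\<^sub>E vecs n. \<Prod>k\<in>K. if c k (p k d) y = 0 then 1 else l')"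
    by (simp add: sum_distrib_left)
  also have "\<dots> \<le> q ^ n * (q ^ (n * d) * (1 - (1 - 1 / q) ^ d * (1 - l')) ^ card K)"
    unfolding c_def q_def
  proof (intro mult_left_mono Suc.IH[of _ "\<lambda>k. restrict (p k) {..<d}"])
    show "leading d n (slice d (p k d) (T k)) (restrict (p k) {..<d})" if "k \<in> K" for k
      using leading_slice[OF Suc.prems(2)[OF that]] .
    show "inj_on (\<lambda>k. restrict (p k) {..<d} s) K" if "s < d" for s
      using Suc.prems(3)[of s] that by simp
  qed (use Suc.prems l' in auto)
  also have "\<dots> = q ^ (n * Suc d) * (1 - (1 - 1 / q) ^ Suc d * (1 - l)) ^ card K"
    by (simp add: power_add l'_def mult_ac)
  finally show ?case by (simp add: q_def)
qed

section \<open>Leading positions and dimension\<close>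

text \<open>Gaussian elimination: one tensor is chosen for each leading position, and subtracting
  multiples of the chosen tensors reduces any element of \<open>V\<close> to 0. Hence the chosen
  tensors span \<open>V\<close>.\<close>

lemma dim_le_card_leading:
  fixes V :: "'f::field tensor set"
  assumes V: "tensor.subspace V" "V \<subseteq> tensor_space d n"
  shows "tensor.dim V \<le> card {p. \<exists>T\<in>V. leading d n T p}" (is "_ \<le> card ?L")
proof -
  have fin: "finite ?L"
    by (rule finite_subset[of _ "{..<d} \<rightarrow>\<^sub>E {..<n}"]) (auto simp: leading_def finite_PiE)
  define f where "f p = (SOME T. T \<in> V \<and> leading d n T p)" for p
  have f: "f p \<in> V \<and> leading d n (f p) p" if "p \<in> ?L" for p
    unfolding f_def by (rule someI_ex[of "\<lambda>T. T \<in> V \<and> leading d n T p"]) (use that in blast)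
  \<comment> \<open>The number \<open>m\<close> bounds how many codes, counted from the top, may
    still carry nonzero entries.\<close>
  have span: "T \<in> tensor.span (f ` ?L)"
    if "T \<in> V" "\<And>i. i \<in> {..<d} \<rightarrow>\<^sub>E {..<n} \<Longrightarrow> index_code d n i + m < n ^ d \<Longrightarrow> T i = 0" for T m
    using that
  proof (induction m arbitrary: T)
    case 0
    have "T i = 0" for i
    proof (cases "i \<in> {..<d} \<rightarrow>\<^sub>E {..<n}")
      case True
      then have "index_code d n i < n ^ d" by (intro index_code_less) auto
      with True 0(2) show ?thesis by simp
    next
      case False
      then show ?thesis using 0(1) V(2) by (auto simp: tensor_space_def)
    qed
    then have "T = 0" by (simp add: fun_eq_iff)
    show ?case unfolding \<open>T = 0\<close> by (rule tensor.span_zero)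
  next
    case (Suc m)
    show ?case
    proof (cases "\<exists>i\<in>{..<d} \<rightarrow>\<^sub>E {..<n}. index_code d n i + m < n ^ d \<and> T i \<noteq> 0")
      case False
      then show ?thesis using Suc by blast
    next
      case True
      then obtain i where i: "i \<in> {..<d} \<rightarrow>\<^sub>E {..<n}" "index_code d n i + m < n ^ d" "T i \<noteq> 0"
        by blast
      have code: "index_code d n i + Suc m = n ^ d"
        using i Suc.prems(2)[of i] by linarith
      have lead: "leading d n T i"
        unfolding leading_def
      proof (intro conjI ballI impI)
        fix i' assume "i' \<in> {..<d} \<rightarrow>\<^sub>E {..<n}" "index_code d n i' < index_code d n i"
        with code show "T i' = 0" by (intro Suc.prems(2)) auto
      qed (use i in auto)
      then have iL: "i \<in> ?L" using Suc.prems(1) by blast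
      define S where "S = f i"
      have S: "S \<in> V" "leading d n S i" using f[OF iL] by (auto simp: S_def)
      \<comment> \<open>The entry at \<open>i\<close> is cancelled, and no entry of smaller code is
        created, since \<open>S\<close> has the same leading position.\<close>
      define U where "U = T - tensor_scale (T i / S i) S"
      have "U \<in> tensor.span (f ` ?L)"
      proof (rule Suc.IH)
        show "U \<in> V"
          unfolding U_def using V(1) S(1) Suc.prems(1)
          by (intro tensor.subspace_diff tensor.subspace_scale)
        fix i' assume i': "i' \<in> {..<d} \<rightarrow>\<^sub>E {..<n}" "index_code d n i' + m < n ^ d"
        then consider "index_code d n i' < index_code d n i" | "index_code d n i' = index_code d n i"
          using code by linarith
        then show "U i' = 0"
        proof cases
          case 1
          then show ?thesis using i' S(2) lead by (simp add: U_def leading_def tensor_scale_def)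
        next
          case 2
          have "i' s = i s" if "s < d" for s
            by (rule index_code_eqD[OF _ _ 2 that]) (use i i' in auto)
          then have "i' = i" using i(1) i'(1) by (intro PiE_ext[of i' "{..<d}"]) auto
          then show ?thesis using S(2) by (simp add: U_def leading_def tensor_scale_def)
        qed
      qed
      moreover have "tensor_scale (T i / S i) S \<in> tensor.span (f ` ?L)"
        unfolding S_def using iL by (intro tensor.span_scale tensor.span_base imageI)
      ultimately have "U + tensor_scale (T i / S i) S \<in> tensor.span (f ` ?L)"
        by (rule tensor.span_add)
      then show ?thesis by (simp add: U_def)
    qed
  qed
  have "V \<subseteq> tensor.span (f ` ?L)"
    \<comment> \<open>For \<open>m = n ^ d\<close> the vanishing condition is vacuous.\<close>
    using span[of _ "n ^ d"] by auto
  then have "tensor.dim V \<le> card (f ` ?L)"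
    using fin by (intro tensor.dim_le_card) auto
  also have "\<dots> \<le> card ?L" using fin by (rule card_image_le)
  finally show ?thesis .
qed

section \<open>Diagonals of the index box\<close>

lemma card_PiE_coordinate_eq_0_le:
  assumes "s < Suc d"
  shows "card {i \<in> {..<Suc d} \<rightarrow>\<^sub>E {..<n::nat}. i s = 0} \<le> n ^ d"
proof -
  have "card {i \<in> {..<Suc d} \<rightarrow>\<^sub>E {..<n}. i s = 0}
      \<le> card (Pi\<^sub>E {..<Suc d} (\<lambda>s'. if s' = s then {0} else {..<n}))"
    by (intro card_mono finite_PiE) (auto simp: PiE_iff extensional_def)
  also have "\<dots> = (\<Prod>s'\<in>{..<Suc d}. if s' = s then 1 else n)"
    by (subst card_PiE) (auto intro!: prod.cong)
  also have "\<dots> = (\<Prod>s'\<in>{..<Suc d} - {s}. n)"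
    using assms by (subst prod.remove[of _ s]) (auto intro!: prod.cong)
  also have "\<dots> = n ^ d" using assms by simp
  finally show ?thesis .
qed

text \<open>The lines in direction \<open>(1, \<dots>, 1)\<close> partition the index box; each one meets a facet where
  some coordinate is \<open>0\<close>, so there are at most \<open>d * n ^ (d - 1)\<close> of them.\<close>

lemma exists_long_diagonal_chain:
  assumes L: "L \<subseteq> {..<Suc d} \<rightarrow>\<^sub>E {..<n::nat}" and n: "n > 0" and card: "t * n ^ d \<le> card L"
  shows "\<exists>m p. t \<le> Suc d * m \<and> (\<forall>k<m. p k \<in> L) \<and>
    (\<forall>k l s. k < l \<and> l < m \<and> s < Suc d \<longrightarrow> p k s < p l s)"
proof -
  define mn where "mn i = Min (i ` {..<Suc d})" for i :: "nat \<Rightarrow> nat"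
  \<comment> \<open>Sliding \<open>i\<close> back along its diagonal reaches a facet at
    \<open>base i\<close>, and \<open>mn i\<close> is the distance travelled. Thus
    \<open>fib b\<close> below is the part of \<open>L\<close> on the diagonal through
    \<open>b\<close>.\<close>
  define base where "base i = (\<lambda>s\<in>{..<Suc d}. i s - mn i)" for i
  define Base where "Base = (\<Union>s<Suc d. {i \<in> {..<Suc d} \<rightarrow>\<^sub>E {..<n}. i s = 0})"
  define fib where "fib b = {i \<in> L. base i = b}" for b
  have finBox: "finite ({..<Suc d} \<rightarrow>\<^sub>E {..<n})" by (intro finite_PiE) auto
  then have finL: "finite L" using L by (rule finite_subset[rotated])
  have mn_le: "mn i \<le> i s" if "s < Suc d" for i s
    unfolding mn_def using that by (intro Min_le) auto
  have "base i \<in> Base" if "i \<in> L" for i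
  proof -
    have "mn i \<in> i ` {..<Suc d}" unfolding mn_def by (intro Min_in) auto
    then obtain s where s: "s < Suc d" "mn i = i s" by auto
    have "i s' - mn i < n" if "s' < Suc d" for s'
      using \<open>i \<in> L\<close> L that by (meson PiE_mem lessThan_iff less_imp_diff_less subset_iff)
    then show ?thesis using s by (auto simp: Base_def base_def)
  qed
  then have "L = (\<Union>b\<in>Base. fib b)" by (auto simp: fib_def)
  moreover have finBase: "finite Base"
    unfolding Base_def by (rule finite_subset[OF _ finBox]) auto
  ultimately have cardL: "card L \<le> (\<Sum>b\<in>Base. card (fib b))"
    using card_UN_le[OF finBase, of fib] by simp
  have "card Base \<le> (\<Sum>s<Suc d. card {i \<in> {..<Suc d} \<rightarrow>\<^sub>E {..<n}. i s = 0})"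
    unfolding Base_def by (intro card_UN_le) auto
  also have "\<dots> \<le> (\<Sum>s<Suc d. n ^ d)"
    by (intro sum_mono card_PiE_coordinate_eq_0_le) auto
  finally have cardBase: "card Base \<le> Suc d * n ^ d" by simp
  \<comment> \<open>Pigeonhole, multiplied through by \<open>Suc d\<close> to stay within natural
    numbers.\<close>
  have "\<exists>b. t \<le> Suc d * card (fib b)"
  proof (rule ccontr)
    assume "\<not> ?thesis"
    then have lt: "Suc d * card (fib b) < t" for b by (meson not_le)
    then have less: "Suc d * card (fib b) \<le> t - 1" for b
      by (metis Suc_pred' less_Suc_eq_le gr_zeroI not_less0)
    have t: "t > 0" using lt[of undefined] by linarith
    have "Suc d * (t * n ^ d) \<le> Suc d * card L" using card by (rule mult_le_mono2)
    also have "\<dots> \<le> Suc d * (\<Sum>b\<in>Base. card (fib b))" using cardL by (rule mult_le_mono2)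
    also have "\<dots> = (\<Sum>b\<in>Base. Suc d * card (fib b))" by (rule sum_distrib_left)
    also have "\<dots> \<le> (\<Sum>b\<in>Base. t - 1)" by (intro sum_mono less)
    also have "\<dots> = card Base * (t - 1)" by simp
    also have "\<dots> \<le> (Suc d * n ^ d) * (t - 1)" using cardBase by (rule mult_le_mono1)
    also have "\<dots> < (Suc d * n ^ d) * t" using t n by (intro mult_strict_left_mono) auto
    finally show False by (simp add: mult_ac)
  qed
  then obtain b where b: "t \<le> Suc d * card (fib b)" by blast
  have coord: "i s = b s + mn i" if "i \<in> fib b" "s < Suc d" for i s
    using that mn_le[OF that(2), of i] by (auto simp: fib_def base_def)
  have inj: "inj_on mn (fib b)"
  proof (rule inj_onI)
    fix i i' assume i: "i \<in> fib b" "i' \<in> fib b" "mn i = mn i'"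
    have "i s = i' s" if "s < Suc d" for s
      using coord[OF i(1) that] coord[OF i(2) that] i(3) by simp
    moreover have "i \<in> {..<Suc d} \<rightarrow>\<^sub>E {..<n}" "i' \<in> {..<Suc d} \<rightarrow>\<^sub>E {..<n}"
      using i L by (auto simp: fib_def)
    ultimately show "i = i'" by (meson PiE_ext lessThan_iff)
  qed
  define m where "m = card (fib b)"
  \<comment> \<open>On one diagonal the distance determines the tuple, and a larger distance
    increases every coordinate. Listing the distances in increasing order therefore gives the
    chain.\<close>
  have "finite (mn ` fib b)" using finL by (simp add: fib_def)
  then obtain h where h: "strict_mono_on {..<card (mn ` fib b)} h"
    "\<forall>k<card (mn ` fib b). h k \<in> mn ` fib b"
    using finite_enumerate by blast
  then have h: "strict_mono_on {..<m} h" "\<forall>k<m. h k \<in> mn ` fib b"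
    by (simp_all add: m_def card_image[OF inj])
  define p where "p k = inv_into (fib b) mn (h k)" for k
  have p: "p k \<in> fib b" "mn (p k) = h k" if "k < m" for k
    using h(2) that by (auto simp: p_def inv_into_into f_inv_into_f)
  have "p k s < p l s" if "k < l" "l < m" "s < Suc d" for k l s
  proof -
    have "h k < h l" using that by (intro strict_mono_onD[OF h(1)]) auto
    then show ?thesis
      using coord[OF p(1)[of k] that(3)] coord[OF p(1)[of l] that(3)] p(2)[of k] p(2)[of l] that
      by simp
  qed
  moreover have "p k \<in> L" if "k < m" for k using p(1)[OF that] by (simp add: fib_def)
  moreover have "t \<le> Suc d * m" using b by (simp add: m_def)
  ultimately show ?thesis by blast
qed

section \<open>Characters, bias and kernels of slices\<close>

lemma character_sum:
  fixes \<chi> :: "'f::field \<Rightarrow> complex"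
  assumes "nontrivial_additive_character \<chi>"
  shows "\<chi> (\<Sum>j\<in>A. f j) = (\<Prod>j\<in>A. \<chi> (f j))"
  using assms by (induction A rule: infinite_finite_induct)
    (auto simp: nontrivial_additive_character_def)

text \<open>Orthogonality: for \<open>c \<noteq> 0\<close>, shifting \<open>w\<close> by
  \<open>a / c\<close> multiplies the sum by \<open>\<chi> a \<noteq> 1\<close>.\<close>

lemma sum_character_mult:
  fixes \<chi> :: "'f::{field,finite} \<Rightarrow> complex"
  assumes "nontrivial_additive_character \<chi>"
  shows "(\<Sum>w\<in>UNIV. \<chi> (w * c)) = (if c = 0 then of_nat CARD('f) else 0)"
proof (cases "c = 0")
  case True
  then show ?thesis using assms by (simp add: nontrivial_additive_character_def)
next
  case False
  obtain a where a: "\<chi> a \<noteq> 1"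
    using assms by (auto simp: nontrivial_additive_character_def)
  have "(\<Sum>w\<in>UNIV. \<chi> (w * c)) = (\<Sum>w\<in>UNIV. \<chi> ((w + a / c) * c))"
    by (rule sum.reindex_bij_witness[of _ "\<lambda>w. w + a / c" "\<lambda>w. w - a / c"]) auto
  also have "\<dots> = (\<Sum>w\<in>UNIV. \<chi> a * \<chi> (w * c))"
    using assms False
    by (intro sum.cong) (auto simp: nontrivial_additive_character_def distrib_right)
  also have "\<dots> = \<chi> a * (\<Sum>w\<in>UNIV. \<chi> (w * c))"
    by (simp add: sum_distrib_left)
  finally show ?thesis using a False by auto
qed

lemma sum_vecs_character:
  fixes \<chi> :: "'f::{field,finite} \<Rightarrow> complex"
  assumes "nontrivial_additive_character \<chi>"
  shows "(\<Sum>z\<in>vecs n. \<chi> (\<Sum>j<n. z j * c j)) = (if \<forall>j<n. c j = 0 then of_nat (CARD('f) ^ n) else 0)"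
proof -
  have "(\<Sum>z\<in>vecs n. \<chi> (\<Sum>j<n. z j * c j)) = (\<Sum>z\<in>{..<n} \<rightarrow>\<^sub>E UNIV. \<Prod>j<n. \<chi> (z j * c j))"
    by (simp add: vecs_def character_sum[OF assms])
  also have "\<dots> = (\<Prod>j<n. \<Sum>w\<in>UNIV. \<chi> (w * c j))"
    by (subst prod_sum_PiE) auto
  also have "\<dots> = (\<Prod>j<n. if c j = 0 then of_nat CARD('f) else 0)"
    by (simp add: sum_character_mult[OF assms])
  also have "\<dots> = (if \<forall>j<n. c j = 0 then of_nat (CARD('f) ^ n) else 0)"
    by (auto simp: prod_zero_iff)
  finally show ?thesis .
qed

text \<open>For \<open>J = n\<close> these are the tuples \<open>y\<close> at which the form
  vanishes identically in its last vector. A smaller \<open>J\<close> restricts the last mode to the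
  indices below \<open>J\<close> and can only enlarge the set.\<close>

definition slice_kernel :: "nat \<Rightarrow> nat \<Rightarrow> nat \<Rightarrow> 'f::field tensor \<Rightarrow> (nat \<Rightarrow> nat \<Rightarrow> 'f) set" where
  "slice_kernel d n J T =
     {y \<in> {..<d} \<rightarrow>\<^sub>E vecs n. \<forall>j<J. tensor_form d n (slice d j T) y = 0}"

lemma finite_slice_kernel [simp]:
  "finite (slice_kernel d n J (T :: 'f::{field,finite} tensor))"
  unfolding slice_kernel_def by (intro finite_Collect_conjI disjI1) (simp add: finite_PiE)

text \<open>Summing the character over the last vector gives \<open>CARD('f) ^ n\<close> if all
  slices vanish and 0 otherwise. The bias is thus a probability that does not depend on the
  character.\<close>

lemma bias_eq_card_slice_kernel:
  fixes T :: "'f::{field,finite} tensor"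
  assumes "nontrivial_additive_character \<chi>"
  shows "bias \<chi> (Suc d) n T = of_nat (card (slice_kernel d n n T)) / of_nat (CARD('f) ^ (n * d))"
proof -
  have "(\<Sum>x\<in>{..<Suc d} \<rightarrow>\<^sub>E vecs n. \<chi> (tensor_form (Suc d) n T x))
      = (\<Sum>y\<in>{..<d} \<rightarrow>\<^sub>E vecs n. if \<forall>j<n. tensor_form d n (slice d j T) y = 0
          then of_nat (CARD('f) ^ n) else 0)"
    unfolding sum_PiE_lessThan_Suc
    by (intro sum.cong refl, subst sum_vecs_character[OF assms, symmetric])
      (simp add: tensor_form_Suc)
  also have "\<dots> = of_nat (card (slice_kernel d n n T)) * of_nat (CARD('f) ^ n)"
    unfolding slice_kernel_def
    by (subst sum.inter_filter[symmetric]) (simp_all add: finite_PiE)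
  finally show ?thesis
    by (simp add: bias_def power_add)
qed

text \<open>Zero vectors annihilate every form with at least one mode. This makes the bias positive,
  so that its logarithm can be compared.\<close>

lemma card_slice_kernel_pos:
  fixes T :: "'f::{field,finite} tensor"
  assumes "d > 0"
  shows "card (slice_kernel d n J T) > 0"
proof -
  let ?y = "\<lambda>k\<in>{..<d}. \<lambda>j\<in>{..<n}. 0 :: 'f"
  have "(\<Prod>k<d. ?y k (i k)) = 0" if "i \<in> {..<d} \<rightarrow>\<^sub>E {..<n}" for i
  proof (rule prod_zero)
    have "i 0 < n" using that assms by auto
    then show "\<exists>k\<in>{..<d}. ?y k (i k) = 0" using assms by (intro bexI[of _ 0]) auto
  qed simp
  then have "?y \<in> slice_kernel d n J T"
    by (auto simp: slice_kernel_def tensor_form_def vecs_def intro!: sum.neutral)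
  then show ?thesis by (auto simp: card_gt_0_iff)
qed

lemma tensor_form_slice_add:
  "tensor_form d n (slice d j (S + T)) y
    = tensor_form d n (slice d j S) y + tensor_form d n (slice d j T) y"
  by (simp add: tensor_form_def slice_def distrib_right sum.distrib)

lemma tensor_form_slice_scale:
  "tensor_form d n (slice d j (tensor_scale a T)) y = a * tensor_form d n (slice d j T) y"
  by (simp add: tensor_form_def slice_def tensor_scale_def sum_distrib_left mult.assoc)

lemma tensor_form_slice_sum:
  "finite K \<Longrightarrow> tensor_form d n (slice d j (\<Sum>k\<in>K. T k)) y
    = (\<Sum>k\<in>K. tensor_form d n (slice d j (T k)) y)"
proof (induction K rule: finite_induct)
  case empty
  show ?case by (simp add: tensor_form_def slice_def)
next
  case (insert k K)
  show ?case
    unfolding sum.insert[OF insert(1,2)] tensor_form_slice_add insert(3) ..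
qed

section \<open>A combination of small bias within one block\<close>

text \<open>The kernel size is averaged over all coefficient vectors \<open>x\<close>. For fixed
  \<open>y\<close>, the slices at the indices \<open>p k d\<close> give a triangular system in
  \<open>x\<close>, solved with probability \<open>1 / q\<close> for each nonzero pivot coefficient,
  where \<open>q = CARD('f)\<close>. The pivot coefficients are then averaged over \<open>y\<close>
  by \<open>sum_weight_leading_le\<close>.\<close>

lemma exists_small_slice_kernel:
  fixes T :: "nat \<Rightarrow> 'f::{field,finite} tensor"
  assumes K: "finite K" and lead: "\<And>k. k \<in> K \<Longrightarrow> leading (Suc d) n (T k) (p k)"
    and mono: "\<And>k l s. k \<in> K \<Longrightarrow> l \<in> K \<Longrightarrow> k < l \<Longrightarrow> s < Suc d \<Longrightarrow> p k s < p l s"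
    and J: "\<And>k. k \<in> K \<Longrightarrow> p k d < J"
  shows "\<exists>x. real (card (slice_kernel d n J (\<Sum>k\<in>K. tensor_scale (x k) (T k))))
    \<le> real CARD('f) ^ (n * d) * (1 - (1 - 1 / real CARD('f)) ^ Suc d) ^ card K"
proof (rule ccontr)
  define q where "q = real CARD('f)"
  define M where "M = q ^ (n * d) * (1 - (1 - 1 / q) ^ Suc d) ^ card K"
  define A where "A x = (\<Sum>k\<in>K. tensor_scale (x k) (T k))" for x
  define c where "c k j y = tensor_form d n (slice d j (T k)) y" for k j y
  assume "\<not> ?thesis"
  then have large: "M < real (card (slice_kernel d n J (A x)))" for x
    by (auto simp: M_def q_def A_def not_le)
  have q: "1 / q \<le> 1" "1 / q \<ge> 0" "q > 0"
    by (simp_all add: Suc_leI q_def)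
  \<comment> \<open>For \<open>l > k\<close> the slice of \<open>T l\<close> at \<open>p k d\<close>
    lies before its leading position and vanishes, so only \<open>l \<le> k\<close>
    contribute.\<close>
  have form: "tensor_form d n (slice d (p k d) (A x)) y
      = c k (p k d) y * x k + (\<Sum>l\<in>{l\<in>K. l < k}. x l * c l (p k d) y)" if "k \<in> K" for k x y
  proof -
    have "tensor_form d n (slice d (p k d) (A x)) y = (\<Sum>l\<in>K. x l * c l (p k d) y)"
      by (simp add: A_def tensor_form_slice_sum K tensor_form_slice_scale c_def)
    also have "\<dots> = (\<Sum>l\<in>insert k {l\<in>K. l < k}. x l * c l (p k d) y)"
    proof (rule sum.mono_neutral_right)
      show "\<forall>l\<in>K - insert k {l \<in> K. l < k}. x l * c l (p k d) y = 0"
      proof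
        fix l assume "l \<in> K - insert k {l \<in> K. l < k}"
        then have "l \<in> K" "k < l" by auto
        then have "c l (p k d) y = 0"
          unfolding c_def using leading_slice_eq_0[OF lead[OF \<open>l \<in> K\<close>]] mono[OF that, of l d]
          by (intro tensor_form_eq_0) auto
        then show "x l * c l (p k d) y = 0" by simp
      qed
    qed (use K that in auto)
    also have "\<dots> = c k (p k d) y * x k + (\<Sum>l\<in>{l\<in>K. l < k}. x l * c l (p k d) y)"
      using K by (subst sum.insert) auto
    finally show ?thesis .
  qed
  have inner: "(\<Sum>x\<in>K \<rightarrow>\<^sub>E UNIV. \<Prod>k\<in>K.
        if tensor_form d n (slice d (p k d) (A x)) y = 0 then 1 else 0)
      \<le> q ^ card K * (\<Prod>k\<in>K. if c k (p k d) y = 0 then 1 else 1 / q)" for y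
  proof -
    have "(\<Sum>x\<in>K \<rightarrow>\<^sub>E UNIV. \<Prod>k\<in>K.
        if c k (p k d) y * x (id k) + (\<Sum>l\<in>{l\<in>K. l < k}. x l * c l (p k d) y) = 0 then 1 else 0)
      \<le> real CARD('f) ^ card K *
        (\<Prod>k\<in>K. if c k (p k d) y = 0 then 1 else 1 - (1 - 1 / real CARD('f)) * (1 - 0 :: real))"
      by (rule triangular_system_sum_le[where rk = id])
        (use K in \<open>auto intro!: sum.cong\<close>)
    moreover have "1 - (1 - 1 / real CARD('f)) * (1 - 0) = 1 / q" by (simp add: q_def)
    ultimately show ?thesis
      unfolding q_def by (simp only: form cong: prod.cong) simp
  qed
  have "M * q ^ card K = (\<Sum>x\<in>K \<rightarrow>\<^sub>E (UNIV :: 'f set). M)"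
    using K by (simp add: card_funcsetE q_def)
  also have "\<dots> < (\<Sum>x\<in>K \<rightarrow>\<^sub>E UNIV. real (card (slice_kernel d n J (A x))))"
    using K large by (intro sum_strict_mono) (auto simp: finite_PiE PiE_eq_empty_iff)
  \<comment> \<open>Of all slices below \<open>J\<close>, only those at the pivot indices are
    kept.\<close>
  also have "\<dots> \<le> (\<Sum>x\<in>K \<rightarrow>\<^sub>E UNIV. \<Sum>y\<in>{..<d} \<rightarrow>\<^sub>E vecs n. \<Prod>k\<in>K.
      if tensor_form d n (slice d (p k d) (A x)) y = 0 then 1 else 0)"
  proof (rule sum_mono)
    fix x
    have "real (card (slice_kernel d n J (A x)))
        = (\<Sum>y\<in>{..<d} \<rightarrow>\<^sub>E vecs n. if \<forall>j<J. tensor_form d n (slice d j (A x)) y = 0 then 1 else 0)"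
      unfolding slice_kernel_def by (subst sum.inter_filter[symmetric]) (simp_all add: finite_PiE)
    also have "\<dots> \<le> (\<Sum>y\<in>{..<d} \<rightarrow>\<^sub>E vecs n. \<Prod>k\<in>K.
        if tensor_form d n (slice d (p k d) (A x)) y = 0 then 1 else 0)"
    proof (rule sum_mono)
      fix y
      show "(if \<forall>j<J. tensor_form d n (slice d j (A x)) y = 0 then 1 else 0)
        \<le> (\<Prod>k\<in>K. if tensor_form d n (slice d (p k d) (A x)) y = 0 then 1 else (0::real))"
        using J by (cases "\<forall>j<J. tensor_form d n (slice d j (A x)) y = 0")
          (auto intro: prod_nonneg)
    qed
    finally show "real (card (slice_kernel d n J (A x))) \<le> \<dots>" .
  qed
  also have "\<dots> = (\<Sum>y\<in>{..<d} \<rightarrow>\<^sub>E vecs n. \<Sum>x\<in>K \<rightarrow>\<^sub>E UNIV. \<Prod>k\<in>K.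
      if tensor_form d n (slice d (p k d) (A x)) y = 0 then 1 else 0)"
    by (rule sum.swap)
  also have "\<dots> \<le> (\<Sum>y\<in>{..<d} \<rightarrow>\<^sub>E vecs n.
      q ^ card K * (\<Prod>k\<in>K. if c k (p k d) y = 0 then 1 else 1 / q))"
    by (intro sum_mono inner)
  also have "\<dots> = q ^ card K * (\<Sum>y\<in>{..<d} \<rightarrow>\<^sub>E vecs n.
      \<Prod>k\<in>K. if tensor_form d n (slice d (p k d) (T k)) y = 0 then 1 else 1 / q)"
    by (simp add: sum_distrib_left c_def)
  \<comment> \<open>Weight \<open>1 / q\<close> in \<open>d\<close> modes: the factor
    \<open>1 - 1 / q\<close> it contributes raises the exponent from \<open>d\<close> to
    \<open>Suc d\<close>.\<close>
  also have "\<dots> \<le> q ^ card K * (q ^ (n * d) * (1 - (1 - 1 / q) ^ d * (1 - 1 / q)) ^ card K)"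
  proof (rule mult_left_mono)
    show "(\<Sum>y\<in>{..<d} \<rightarrow>\<^sub>E vecs n.
        \<Prod>k\<in>K. if tensor_form d n (slice d (p k d) (T k)) y = 0 then 1 else 1 / q)
      \<le> q ^ (n * d) * (1 - (1 - 1 / q) ^ d * (1 - 1 / q)) ^ card K"
      unfolding q_def
    proof (rule sum_weight_leading_le[where p = "\<lambda>k. restrict (p k) {..<d}"])
      show "leading d n (slice d (p k d) (T k)) (restrict (p k) {..<d})" if "k \<in> K" for k
        using leading_slice[OF lead[OF that]] .
      show "inj_on (\<lambda>k. restrict (p k) {..<d} s) K" if "s < d" for s
      proof (rule inj_onI)
        fix k l assume kl: "k \<in> K" "l \<in> K" "restrict (p k) {..<d} s = restrict (p l) {..<d} s"
        then show "k = l"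
          using mono[of k l s] mono[of l k s] that by (cases k l rule: linorder_cases) auto
      qed
    qed (use K q in \<open>auto simp: q_def\<close>)
  qed (use q in auto)
  also have "\<dots> = M * q ^ card K"
    by (simp add: M_def mult_ac)
  finally show False by simp
qed

section \<open>Spans over several blocks and the final bound\<close>

text \<open>Blocks are added from the last one downwards, so each new combination belongs to the
  earliest block present. Below the cutoff \<open>J\<close> of that block the span built so far is
  invisible, and the new combination alone controls the kernel.\<close>

lemma exists_independent_high_rank:
  fixes T :: "nat \<Rightarrow> 'f::{field,finite} tensor"
  assumes lead: "\<And>k. k < m \<Longrightarrow> leading (Suc d) n (T k) (p k)"
    and mono: "\<And>k l s. k < l \<Longrightarrow> l < m \<Longrightarrow> s < Suc d \<Longrightarrow> p k s < p l s"
    and r: "r > 0"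
    and \<mu>: "\<mu> = 1 - (1 - 1 / real CARD('f)) ^ Suc d" "0 \<le> \<mu>" "\<mu> < 1"
  shows "b * r \<le> m \<Longrightarrow> \<exists>B. tensor.independent B \<and> card B = b \<and> finite B \<and>
    B \<subseteq> tensor.span (T ` {m - b * r..<m}) \<and>
    (\<forall>S\<in>tensor.span B. S \<noteq> 0 \<longrightarrow>
      real (card (slice_kernel d n n S)) \<le> real CARD('f) ^ (n * d) * \<mu> ^ r)"
proof (induction b)
  case 0
  show ?case by (intro exI[of _ "{}"]) (simp add: tensor.independent_empty)
next
  case (Suc b)
  then have "b * r \<le> m" by simp
  from Suc.IH[OF this]
  obtain B where B: "tensor.independent B" "card B = b" "finite B"
    "B \<subseteq> tensor.span (T ` {m - b * r..<m})"
    "\<And>S. S \<in> tensor.span B \<Longrightarrow> S \<noteq> 0 \<Longrightarrow>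
      real (card (slice_kernel d n n S)) \<le> real CARD('f) ^ (n * d) * \<mu> ^ r"
    by blast
  define k0 where "k0 = m - Suc b * r"
  define K where "K = {k0..<k0 + r}"
  \<comment> \<open>The cutoff separates the blocks: last coordinates of leading positions are below
    \<open>J\<close> in this block and at least \<open>J\<close> in all later ones.\<close>
  define J where "J = Suc (p (k0 + r - 1) d)"
  have k0: "k0 + r = m - b * r" "k0 + r \<le> m" using Suc.prems by (auto simp: k0_def)
  have Jn: "J \<le> n"
    using lead[of "k0 + r - 1"] k0 r by (auto simp: leading_def J_def Suc_le_eq)
  have "\<exists>x. real (card (slice_kernel d n J (\<Sum>k\<in>K. tensor_scale (x k) (T k))))
      \<le> real CARD('f) ^ (n * d) * (1 - (1 - 1 / real CARD('f)) ^ Suc d) ^ card K"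
  proof (rule exists_small_slice_kernel)
    fix k assume "k \<in> K"
    then show "p k d < J"
      using mono[of k "k0 + r - 1" d] k0 r
      by (cases "k = k0 + r - 1") (auto simp: K_def J_def less_Suc_eq)
  qed (use k0 in \<open>auto simp: K_def intro!: lead mono\<close>)
  then obtain x where x: "real (card (slice_kernel d n J (\<Sum>k\<in>K. tensor_scale (x k) (T k))))
      \<le> real CARD('f) ^ (n * d) * \<mu> ^ r"
    by (auto simp: \<mu>(1) K_def)
  define A where "A = (\<Sum>k\<in>K. tensor_scale (x k) (T k))"
  have A: "real (card (slice_kernel d n J A)) \<le> real CARD('f) ^ (n * d) * \<mu> ^ r"
    using x by (simp add: A_def)
  have A_span: "A \<in> tensor.span (T ` {k0..<m})"
    unfolding A_def using k0
    by (intro tensor.span_sum tensor.span_scale tensor.span_base) (auto simp: K_def)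
  \<comment> \<open>Every tensor of a later block vanishes where the last coordinate is below \<open>J\<close>.\<close>
  have later: "tensor_form d n (slice d j S) y = 0" if S: "S \<in> tensor.span B" and "j < J" for S j y
  proof -
    let ?Z = "{S. tensor_form d n (slice d j S) y = 0}"
    have "tensor.subspace ?Z"
      by (rule tensor.subspaceI)
        (simp_all add: tensor_form_slice_add tensor_form_slice_scale,
          simp add: tensor_form_def slice_def)
    moreover have "T ` {m - b * r..<m} \<subseteq> ?Z"
    proof safe
      fix k assume k: "k \<in> {m - b * r..<m}"
      then have "k0 + r - 1 < k" "k < m" using k0 r by auto
      then have "j < p k d"
        using mono[of "k0 + r - 1" k d] \<open>j < J\<close> by (simp add: J_def)
      then show "tensor_form d n (slice d j (T k)) y = 0"
        using k leading_slice_eq_0[OF lead] by (intro tensor_form_eq_0) auto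
    qed
    ultimately have "tensor.span (T ` {m - b * r..<m}) \<subseteq> ?Z" by (intro tensor.span_minimal)
    moreover have "tensor.span B \<subseteq> tensor.span (T ` {m - b * r..<m})"
      using B(4) by (intro tensor.span_minimal tensor.subspace_span)
    ultimately show ?thesis using S by blast
  qed
  \<comment> \<open>Otherwise all slices of \<open>A\<close> below \<open>J\<close> would vanish and
    its truncated kernel would be everything, contradicting \<open>\<mu> ^ r < 1\<close>.\<close>
  have A_notin: "A \<notin> tensor.span B"
  proof
    assume "A \<in> tensor.span B"
    then have "slice_kernel d n J A = {..<d} \<rightarrow>\<^sub>E vecs n"
      using later by (auto simp: slice_kernel_def)
    then have "real CARD('f) ^ (n * d) \<le> real CARD('f) ^ (n * d) * \<mu> ^ r"
      using A by (simp add: card_funcsetE card_vecs power_mult)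
    moreover have "\<mu> ^ r < 1" using \<mu> r by (simp add: power_less_one_iff)
    ultimately show False by (simp add: mult_le_cancel_left1 not_le)
  qed
  have high: "real (card (slice_kernel d n n S)) \<le> real CARD('f) ^ (n * d) * \<mu> ^ r"
    if S: "S \<in> tensor.span (insert A B)" "S \<noteq> 0" for S
  proof -
    obtain a where a: "S - tensor_scale a A \<in> tensor.span B"
      using S(1) by (auto simp: tensor.span_breakdown_eq)
    show ?thesis
    proof (cases "a = 0")
      case True
      then have "S \<in> tensor.span B" using a by (metis tensor.scale_zero_left diff_zero)
      then show ?thesis using B(5) S(2) by blast
    next
      case False
      \<comment> \<open>Below \<open>J\<close> the slices of \<open>S\<close> agree, as forms, with
        \<open>a\<close> times those of \<open>A\<close>.\<close>
      have "tensor_form d n (slice d j A) y = 0"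
        if "j < J" "tensor_form d n (slice d j S) y = 0" for j y
      proof -
        have "tensor_form d n (slice d j ((S - tensor_scale a A) + tensor_scale a A)) y
            = a * tensor_form d n (slice d j A) y"
          unfolding tensor_form_slice_add tensor_form_slice_scale using later[OF a that(1)] by simp
        then show ?thesis using that(2) False by (simp only: diff_add_cancel) simp
      qed
      then have "slice_kernel d n n S \<subseteq> slice_kernel d n J A"
        using Jn by (auto simp: slice_kernel_def)
      then have "card (slice_kernel d n n S) \<le> card (slice_kernel d n J A)"
        by (intro card_mono) auto
      with A show ?thesis by linarith
    qed
  qed
  have "tensor.span (T ` {m - b * r..<m}) \<subseteq> tensor.span (T ` {k0..<m})"
    using k0 by (intro tensor.span_mono image_mono) auto
  then have "insert A B \<subseteq> tensor.span (T ` {m - Suc b * r..<m})"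
    using A_span B(4) by (auto simp: k0_def)
  moreover have "tensor.independent (insert A B)"
    by (rule tensor.independent_insertI[OF A_notin B(1)])
  moreover have "card (insert A B) = Suc b"
    using A_notin B(2,3) tensor.span_base by (subst card_insert_disjoint) auto
  ultimately show ?case using B(3) high by blast
qed

theorem theorem1p3:
  fixes d :: nat
  assumes "d \<ge> 2"
  shows "\<exists>c::real. 0 < c \<and> c \<le> 1 \<and>
    (\<forall>(n::nat) (t::nat) (r::nat) (V :: 'f::{field,finite} tensor set).
       n \<ge> t \<and> t \<ge> r \<and> r \<ge> 1 \<and>
       V \<subseteq> tensor_space d n \<and> tensor.subspace V \<and> tensor.dim V \<ge> t * n ^ (d - 1) \<longrightarrow>
       (\<exists>W. W \<subseteq> V \<and> tensor.subspace W \<and>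
          real (tensor.dim W) \<ge> real t / (real d * real r) - 1 \<and>
          (\<forall>T\<in>W. T \<noteq> 0 \<longrightarrow>
             (\<forall>\<chi>. nontrivial_additive_character \<chi> \<longrightarrow>
                analytic_rank \<chi> d n T \<ge> c * real r))))"
proof -
  obtain e where e: "d = Suc e" "e > 0" using assms by (cases d) auto
  define q where "q = real CARD('f)"
  define \<mu> where "\<mu> = 1 - (1 - 1 / q) ^ d"
  have "card {0, 1 :: 'f} \<le> CARD('f)" by (rule card_mono) auto
  then have q: "q > 1" by (simp add: q_def)
  \<comment> \<open>This gives \<open>\<mu> \<ge> 1 / q\<close>, which is what makes
    \<open>c \<le> 1\<close>.\<close>
  have "(1 - 1 / q) ^ d \<le> (1 - 1 / q) ^ 1"
    using q e by (intro power_decreasing) auto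
  then have \<mu>_ge: "1 / q \<le> \<mu>" by (simp add: \<mu>_def)
  have "(1 - 1 / q) ^ d > 0" using q by (intro zero_less_power) simp
  then have \<mu>_less: "\<mu> < 1" by (simp add: \<mu>_def)
  have "1 / q > 0" using q by simp
  with \<mu>_ge have \<mu>_pos: "\<mu> > 0" by linarith
  \<comment> \<open>Chosen so that a bias of at most \<open>\<mu> ^ r\<close> means analytic rank at
    least \<open>c * r\<close>; it depends only on the field and \<open>d\<close>.\<close>
  define c where "c = - log q \<mu>"
  have "log q (1 / q) \<le> log q \<mu>" using \<mu>_ge \<mu>_pos q by (subst log_le_cancel_iff) auto
  then have c: "0 < c" "c \<le> 1"
    using \<mu>_less \<mu>_pos q by (simp_all add: c_def log_divide)
  have main: "\<exists>W. W \<subseteq> V \<and> tensor.subspace W \<and>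
      real (tensor.dim W) \<ge> real t / (real d * real r) - 1 \<and>
      (\<forall>T\<in>W. T \<noteq> 0 \<longrightarrow> (\<forall>\<chi>. nontrivial_additive_character \<chi> \<longrightarrow>
        analytic_rank \<chi> d n T \<ge> c * real r))"
    if h: "n \<ge> t" "t \<ge> r" "r \<ge> 1" "V \<subseteq> tensor_space d n" "tensor.subspace V"
      "tensor.dim V \<ge> t * n ^ (d - 1)" for n t r and V :: "'f tensor set"
  proof -
    define L where "L = {p. \<exists>T\<in>V. leading (Suc e) n T p}"
    have cardL: "t * n ^ e \<le> card L"
      using h(6) dim_le_card_leading[OF h(5,4)] by (simp add: e(1) L_def)
    have LE: "L \<subseteq> {..<Suc e} \<rightarrow>\<^sub>E {..<n}" by (auto simp: L_def leading_def)
    have "n > 0" using h(1-3) by simp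
    from exists_long_diagonal_chain[OF LE this cardL]
    obtain m p where p: "t \<le> Suc e * m" "\<And>k. k < m \<Longrightarrow> p k \<in> L"
      "\<And>k l s. k < l \<Longrightarrow> l < m \<Longrightarrow> s < Suc e \<Longrightarrow> p k s < p l s"
      by blast
    define T where "T k = (SOME T. T \<in> V \<and> leading (Suc e) n T (p k))" for k
    have T: "T k \<in> V \<and> leading (Suc e) n (T k) (p k)" if "k < m" for k
      unfolding T_def by (rule someI_ex[of "\<lambda>T. T \<in> V \<and> leading (Suc e) n T (p k)"])
        (use p(2)[OF that] in \<open>auto simp: L_def\<close>)
    \<comment> \<open>The number of full blocks. Rounding down here is the source of the
      \<open>- 1\<close> in the dimension bound.\<close>
    define b where "b = m div r"
    have "\<exists>B. tensor.independent B \<and> card B = b \<and> finite B \<and>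
        B \<subseteq> tensor.span (T ` {m - b * r..<m}) \<and>
        (\<forall>S\<in>tensor.span B. S \<noteq> 0 \<longrightarrow>
          real (card (slice_kernel e n n S)) \<le> real CARD('f) ^ (n * e) * \<mu> ^ r)"
    proof (rule exists_independent_high_rank[where p = p])
      show "\<mu> = 1 - (1 - 1 / real CARD('f)) ^ Suc e" by (simp add: \<mu>_def q_def e(1))
    qed (use T p(3) h(3) \<mu>_pos \<mu>_less in \<open>auto simp: b_def\<close>)
    then obtain B where B: "tensor.independent B" "card B = b"
      "B \<subseteq> tensor.span (T ` {m - b * r..<m})"
      "\<And>S. S \<in> tensor.span B \<Longrightarrow> S \<noteq> 0 \<Longrightarrow>
        real (card (slice_kernel e n n S)) \<le> q ^ (n * e) * \<mu> ^ r"
      by (auto simp: q_def)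
    have "tensor.span (T ` {m - b * r..<m}) \<subseteq> V"
      using T h(5) by (intro tensor.span_minimal) auto
    then have "tensor.span B \<subseteq> V"
      using B(3) h(5) by (intro tensor.span_minimal) auto
    moreover have "real t / (real d * real r) - 1 \<le> real (tensor.dim (tensor.span B))"
    proof -
      have "m < Suc b * r"
        unfolding b_def using h(3) dividend_less_div_times[of r m] by simp
      then have "Suc e * m \<le> Suc e * (Suc b * r)" by (intro mult_le_mono2) simp
      with p(1) have "t \<le> Suc e * (Suc b * r)" by simp
      then have "real t \<le> real (d * (Suc b * r))" by (simp only: of_nat_le_iff e(1))
      then have "real t \<le> (real b + 1) * (real d * real r)" by (simp add: algebra_simps)
      then have "real t / (real d * real r) \<le> real b + 1"
        using h(3) e by (simp add: divide_le_eq)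
      then show ?thesis using B(1,2) by (simp add: tensor.dim_eq_card_independent)
    qed
    moreover have "analytic_rank \<chi> d n S \<ge> c * real r"
      if "S \<in> tensor.span B" "S \<noteq> 0" "nontrivial_additive_character \<chi>" for S \<chi>
    proof -
      define \<beta> where "\<beta> = real (card (slice_kernel e n n S)) / q ^ (n * e)"
      have "bias \<chi> d n S = of_real \<beta>"
        using bias_eq_card_slice_kernel[OF that(3), of e n S] by (simp add: e(1) \<beta>_def q_def)
      then have "Re (bias \<chi> d n S) = \<beta>" by simp
      moreover have "\<beta> > 0"
        using card_slice_kernel_pos[OF e(2), of n n S] q by (simp add: \<beta>_def)
      moreover have "\<beta> \<le> \<mu> ^ r"
        using B(4)[OF that(1,2)] q by (simp add: \<beta>_def divide_le_eq mult.commute)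
      ultimately have "log q (Re (bias \<chi> d n S)) \<le> log q (\<mu> ^ r)"
        using q \<mu>_pos by (subst log_le_cancel_iff) auto
      also have "\<dots> = real r * log q \<mu>" using \<mu>_pos by (simp add: log_nat_power)
      finally show ?thesis by (simp add: analytic_rank_def c_def q_def mult.commute)
    qed
    ultimately show ?thesis
      by (intro exI[of _ "tensor.span B"]) (auto simp: tensor.subspace_span)
  qed
  show ?thesis
    by (rule exI[of _ c]) (use c main in blast)
qed

end
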